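(* Let $f:[0,1]\to[0,1]$ be continuous and transitive. Then the dynamical system $([0,1],f)$ is strachite.
   Context: $\mathbb{N}$ is the set of positive integers and $\mathbb{N}_0=\mathbb{N}\cup\{0\}$. Transitive means topologically transitive: for all nonempty open sets $U,V\subseteq[0,1]$ there exists $k\in\mathbb{N}$ with $U\cap f^k(V)\neq\emptyset$. The interval $[0,1]$ has its usual metric. Open dynamical systems. Let $(\mathcal{M},d)$ be a compact metric space, $f:\mathcal{M}\to\mathcal{M}$ continuous, $N\in\mathbb{N}$, $p_1,\dots,p_N\in\mathcal{M}$ pairwise distinct points (the centers), and for each $i=1,\dots,N$ let $\{\rho^i_n\}_{n=1}^\infty$ be a decreasing sequence of positive real numbers with $\lim_{n\to\infty}\rho^i_n=0$. Let $B^i_n=B_{\rho^i_n}(p_i)$ be the open ball with center $p_i$ and radius $\rho^i_n$. With the convention $\min\emptyset=+\infty$, a point $x\in\mathcal{M}$ belongs to $\mathfrak{T}(i)$ if for infinitely many $n\in\mathbb{N}$ the inequality $$\min\{k\in\mathbb{N}_0:f^k(x)\in B^i_n\}<\min\{k\in\mathbb{N}_0:f^k(x)\in B^j_n\}$$ holds for all $j\in\{1,\dots,N\}$ with $j\neq i$. Put $\mathfrak{T}=\bigcap_{j=1}^N\mathfrak{T}(j)$. A subset of a topological space is residual if its complement is a countable union of nowhere dense sets. The open dynamical system given by $(\mathcal{M},d,f)$, the $p_i$ and the $\rho^i_n$ is completely indecisive if $\mathfrak{T}$ is residual in $\mathcal{M}$. Strachite. $(\mathcal{M},f)$ is strachite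 if for every $N\in\mathbb{N}$ there exists a residual set $\mathcal{R}\subseteq\mathcal{M}^N$ such that, for every $(p_1,\dots,p_N)\in\mathcal{R}$ with pairwise distinct entries and every collection of decreasing sequences of positive reals $\{\rho^i_n\}_{n=1}^\infty$, $i=1,\dots,N$, each converging to $0$, the corresponding open dynamical system is completely indecisive. *)

theory Defs
  imports "HOL-Analysis.Analysis" "HOL-Library.Extended_Nat"
begin

definition nowhere_dense_in :: "'a topology \<Rightarrow> 'a set \<Rightarrow> bool" where
  "nowhere_dense_in X A \<longleftrightarrow>
     A \<subseteq> topspace X \<and> X interior_of (X closure_of A) = {}"

definition residual_in :: "'a topology \<Rightarrow> 'a set \<Rightarrow> bool" where
  "residual_in X S \<longleftrightarrow>
     S \<subseteq> topspace X \<and>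
     (\<exists>\<F>. countable \<F> \<and> (\<forall>A\<in>\<F>. nowhere_dense_in X A) \<and> topspace X - S = \<Union>\<F>)"

text \<open>
  A dynamical system is given by a carrier set \<open>M\<close> of an ambient metric space and a total
  function \<open>f\<close>. Only the values of \<open>f\<close> on \<open>M\<close> are relevant, since \<open>f ` M \<subseteq> M\<close> will be assumed.
\<close>

definition topologically_transitive_on :: "'a::topological_space set \<Rightarrow> ('a \<Rightarrow> 'a) \<Rightarrow> bool" where
  "topologically_transitive_on M f \<longleftrightarrow>
     (\<forall>U V. openin (top_of_set M) U \<and> U \<noteq> {} \<and> openin (top_of_set M) V \<and> V \<noteq> {} \<longrightarrow>
        (\<exists>k\<ge>1. U \<inter> (f ^^ k) ` V \<noteq> {}))"

text \<open>
  The infimum in \<^typ>\<open>enat\<close> is the minimum for a nonempty set and \<open>\<infinity>\<close> for the empty set.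
\<close>

definition hitting_time :: "('a \<Rightarrow> 'a) \<Rightarrow> 'a set \<Rightarrow> 'a \<Rightarrow> enat" where
  "hitting_time f B x = Inf (enat ` {k. (f ^^ k) x \<in> B})"

text \<open>
  Centers and radius sequences are indexed by \<open>{1..N}\<close>; the sequences themselves are indexed
  from 0 rather than from 1, which does not affect any condition stated for infinitely many \<open>n\<close>.
\<close>

definition hole :: "'a::metric_space set \<Rightarrow> (nat \<Rightarrow> 'a) \<Rightarrow> (nat \<Rightarrow> nat \<Rightarrow> real) \<Rightarrow> nat \<Rightarrow> nat \<Rightarrow> 'a set" where
  "hole M p \<rho> i n = ball (p i) (\<rho> i n) \<inter> M"

definition first_hits ::
  "'a::metric_space set \<Rightarrow> ('a \<Rightarrow> 'a) \<Rightarrow> nat \<Rightarrow> (nat \<Rightarrow> 'a) \<Rightarrow> (nat \<Rightarrow> nat \<Rightarrow> real) \<Rightarrow> nat \<Rightarrow> 'a set" where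
  "first_hits M f N p \<rho> i =
     {x \<in> M. \<exists>\<^sub>\<infinity>n. \<forall>j\<in>{1..N}. j \<noteq> i \<longrightarrow>
        hitting_time f (hole M p \<rho> i n) x < hitting_time f (hole M p \<rho> j n) x}"

definition completely_indecisive ::
  "'a::metric_space set \<Rightarrow> ('a \<Rightarrow> 'a) \<Rightarrow> nat \<Rightarrow> (nat \<Rightarrow> 'a) \<Rightarrow> (nat \<Rightarrow> nat \<Rightarrow> real) \<Rightarrow> bool" where
  "completely_indecisive M f N p \<rho> \<longleftrightarrow>
     residual_in (top_of_set M) (\<Inter>i\<in>{1..N}. first_hits M f N p \<rho> i)"

text \<open>
  Points of the power \<open>M\<^sup>N\<close> are the extensional functions in \<^term>\<open>PiE {1..N} (\<lambda>_. M)\<close>.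
  ``Decreasing'' is read in the weak sense, which includes all strictly decreasing sequences.
\<close>

definition strachite :: "'a::metric_space set \<Rightarrow> ('a \<Rightarrow> 'a) \<Rightarrow> bool" where
  "strachite M f \<longleftrightarrow>
     (\<forall>N\<ge>1. \<exists>R. residual_in (product_topology (\<lambda>_. top_of_set M) {1..N}) R \<and>
        (\<forall>p\<in>R. inj_on p {1..N} \<longrightarrow>
           (\<forall>\<rho>. (\<forall>i\<in>{1..N}. decseq (\<rho> i) \<and> (\<forall>n. 0 < \<rho> i n) \<and> \<rho> i \<longlonglongrightarrow> 0) \<longrightarrow>
              completely_indecisive M f N p \<rho>)))"

end

theory Submission
  imports Defs
begin

text \<open>
  Suppose that a trajectory starting at \<open>x\<close> reaches a center \<open>p\<^sub>i\<close> exactly, at time \<open>k\<close>. If none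
  of the points \<open>x, f x, \<dots>, f\<^sup>k x\<close> is another center, then for all large \<open>n\<close> the trajectory of \<open>x\<close>
  enters the \<open>n\<close>-th hole around \<open>p\<^sub>i\<close> before the other holes, and so do the trajectories of all
  points near \<open>x\<close>, whatever the radii are. If such points \<open>x\<close> are dense, then the set of points
  for which hole \<open>i\<close> wins infinitely often contains a countable intersection of dense open sets
  (lemma \<open>residual_first_hits\<close>). So two properties of the centers suffice: the backward orbit of
  each \<open>p\<^sub>i\<close> is dense, and no \<open>p\<^sub>i\<close> lies on the forward orbit of another \<open>p\<^sub>j\<close>, because a trajectory
  that visits \<open>p\<^sub>j\<close> on its way to \<open>p\<^sub>i\<close> makes \<open>p\<^sub>i\<close> an iterate of \<open>p\<^sub>j\<close>.

  Both properties are generic. For fixed \<open>i\<close>, \<open>j\<close> and \<open>m\<close>, the tuples with \<open>f\<^sup>m p\<^sub>j = p\<^sub>i\<close> form a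
  graph over the coordinates other than \<open>i\<close>, hence a closed nowhere dense set in a space without
  isolated points. The backward orbit of \<open>y\<close> is dense if and only if \<open>y\<close> belongs to
  \<open>\<Union>k. f\<^sup>k J\<close> for every \<open>J\<close> in a countable family of open intervals that contains a subset of each
  nonempty open set. Here the interval enters: the sets \<open>f\<^sup>k J\<close> are connected, their union is dense
  by transitivity, and none of them is a single point. They are therefore nondegenerate intervals,
  whose interiors form a dense open set
  (lemmas \<open>transitive_iterate_not_constant\<close> and \<open>residual_dense_backward_orbit_interval\<close>).
\<close>

section \<open>Residual sets\<close>

lemma nowhere_dense_in_subset:
  assumes "nowhere_dense_in X A" "B \<subseteq> A"
  shows "nowhere_dense_in X B"
  using assms closure_of_mono[OF assms(2)] interior_of_mono
  unfolding nowhere_dense_in_def by (metis subset_empty subset_trans)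

lemma nowhere_dense_in_complement_dense_open:
  assumes "openin X U" "X closure_of U = topspace X"
  shows "nowhere_dense_in X (topspace X - U)"
proof -
  have "closedin X (topspace X - U)"
    using assms(1) by blast
  then show ?thesis
    using assms(2) by (simp add: nowhere_dense_in_def closure_of_closedin interior_of_complement)
qed

text \<open>
  Dense open sets are easier to handle than nowhere dense ones, so residual sets enter the
  arguments below only through this characterisation.
\<close>

lemma residual_in_iff_dense_open:
  "residual_in X S \<longleftrightarrow> S \<subseteq> topspace X \<and>
     (\<exists>\<U>. countable \<U> \<and> (\<forall>U\<in>\<U>. openin X U \<and> X closure_of U = topspace X) \<and>
          topspace X \<inter> \<Inter>\<U> \<subseteq> S)"
    (is "_ \<longleftrightarrow> _ \<and> ?R")
proof (intro iffI conjI; (elim conjE)?)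
  assume "residual_in X S"
  then obtain \<F> where F: "countable \<F>" "\<And>A. A \<in> \<F> \<Longrightarrow> nowhere_dense_in X A"
      "topspace X - S = \<Union>\<F>"
    by (auto simp: residual_in_def)
  let ?\<U> = "(\<lambda>A. topspace X - X closure_of A) ` \<F>"
  have "openin X U \<and> X closure_of U = topspace X" if "U \<in> ?\<U>" for U
    using that F(2) by (auto simp: nowhere_dense_in_def closure_of_complement)
  moreover have "topspace X \<inter> \<Inter>?\<U> \<subseteq> S"
  proof
    fix x assume x: "x \<in> topspace X \<inter> \<Inter>?\<U>"
    show "x \<in> S"
    proof (rule ccontr)
      assume "x \<notin> S"
      then obtain A where A: "A \<in> \<F>" "x \<in> A"
        using x F(3) by blast
      then have "x \<in> X closure_of A"
        using x by (meson IntD1 closure_of_subset_Int in_mono IntI)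
      then show False
        using x A by blast
    qed
  qed
  ultimately show ?R
    using F(1) by (intro exI[of _ ?\<U>]) blast
next
  assume "residual_in X S"
  then show "S \<subseteq> topspace X"
    by (simp add: residual_in_def)
next
  assume S: "S \<subseteq> topspace X" and ?R
  then obtain \<U> where U: "countable \<U>"
      "\<And>U. U \<in> \<U> \<Longrightarrow> openin X U \<and> X closure_of U = topspace X"
      "topspace X \<inter> \<Inter>\<U> \<subseteq> S"
    by blast
  \<comment> \<open>Removing \<open>S\<close> from each complement makes the union equal to the complement of \<open>S\<close>.\<close>
  let ?\<F> = "(\<lambda>U. (topspace X - U) - S) ` \<U>"
  have "nowhere_dense_in X A" if "A \<in> ?\<F>" for A
    using that U(2) nowhere_dense_in_complement_dense_open nowhere_dense_in_subset
    by (metis (no_types, lifting) Diff_subset imageE)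
  moreover have "topspace X - S = \<Union>?\<F>"
    using U(3) by blast
  ultimately show "residual_in X S"
    using S U(1) unfolding residual_in_def by (intro conjI exI[of _ ?\<F>]) auto
qed

lemma residual_in_dense_open:
  assumes "openin X U" "X closure_of U = topspace X"
  shows "residual_in X U"
  unfolding residual_in_iff_dense_open
  using assms openin_subset by (intro conjI exI[of _ "{U}"]) auto

lemma residual_in_mono:
  assumes "residual_in X S" "S \<subseteq> T" "T \<subseteq> topspace X"
  shows "residual_in X T"
  using assms unfolding residual_in_iff_dense_open by (meson subset_trans)

lemma residual_in_INT:
  assumes "countable I" and "\<And>i. i \<in> I \<Longrightarrow> residual_in X (S i)"
  shows "residual_in X (topspace X \<inter> (\<Inter>i\<in>I. S i))"
proof -
  have "\<forall>i\<in>I. \<exists>\<U>. countable \<U> \<and> (\<forall>U\<in>\<U>. openin X U \<and> X closure_of U = topspace X) \<and>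
          topspace X \<inter> \<Inter>\<U> \<subseteq> S i"
    using assms(2) by (simp add: residual_in_iff_dense_open)
  then obtain \<U> where U: "\<And>i. i \<in> I \<Longrightarrow> countable (\<U> i) \<and>
      (\<forall>U\<in>\<U> i. openin X U \<and> X closure_of U = topspace X) \<and> topspace X \<inter> \<Inter>(\<U> i) \<subseteq> S i"
    by metis
  have "countable (\<Union>i\<in>I. \<U> i)"
    using assms(1) U by blast
  moreover have "topspace X \<inter> \<Inter>(\<Union>i\<in>I. \<U> i) \<subseteq> topspace X \<inter> (\<Inter>i\<in>I. S i)"
  proof (intro subsetI IntI INT_I)
    fix x i assume x: "x \<in> topspace X \<inter> \<Inter>(\<Union>i\<in>I. \<U> i)" and i: "i \<in> I"
    then have "x \<in> topspace X \<inter> \<Inter>(\<U> i)"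
      by blast
    then show "x \<in> S i"
      using U[OF i] by blast
  qed blast
  ultimately show ?thesis
    unfolding residual_in_iff_dense_open using U
    by (intro conjI exI[of _ "\<Union>i\<in>I. \<U> i"]) blast+
qed

lemma residual_in_Int:
  assumes "residual_in X S" "residual_in X T"
  shows "residual_in X (S \<inter> T)"
proof -
  have "residual_in X (topspace X \<inter> (\<Inter>A\<in>{S, T}. A))"
    using assms by (intro residual_in_INT) auto
  then show ?thesis
    using assms(1) by (simp add: residual_in_def Int_absorb1 le_infI1)
qed

section \<open>Residual sets in products\<close>

text \<open>
  Any point of a nonempty open set can be moved inside that set by changing one coordinate only.
\<close>

lemma dense_in_product_if_fibres_dense:
  assumes i: "i \<in> I"
    and fib: "\<And>q. q \<in> topspace (product_topology X I) \<Longrightarrow>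
                X i closure_of {y \<in> topspace (X i). q(i := y) \<in> U} = topspace (X i)"
  shows "product_topology X I closure_of U = topspace (product_topology X I)"
  unfolding dense_intersects_open
proof (intro allI impI, elim conjE)
  fix T assume T: "openin (product_topology X I) T" and "T \<noteq> {}"
  then obtain q where q: "q \<in> T"
    by blast
  then have q': "q \<in> topspace (product_topology X I)"
    using T openin_subset by blast
  have "continuous_map (X i) (product_topology X I) (\<lambda>y. q(i := y))"
    unfolding continuous_map_componentwise
  proof (intro conjI ballI)
    show "(\<lambda>y. q(i := y)) ` topspace (X i) \<subseteq> extensional I"
      using q' i by (auto simp: PiE_def extensional_def)
    show "continuous_map (X i) (X k) (\<lambda>y. (q(i := y)) k)" if "k \<in> I" for k
      using q' that by (cases "k = i") (auto simp: PiE_iff)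
  qed
  then have "openin (X i) {y \<in> topspace (X i). q(i := y) \<in> T}"
    using T openin_continuous_map_preimage by fastforce
  moreover have "q i \<in> {y \<in> topspace (X i). q(i := y) \<in> T}"
    using q q' i by (auto simp: PiE_iff)
  ultimately have "{y \<in> topspace (X i). q(i := y) \<in> U} \<inter> {y \<in> topspace (X i). q(i := y) \<in> T} \<noteq> {}"
    using fib[OF q'] unfolding dense_intersects_open by blast
  then show "U \<inter> T \<noteq> {}"
    by blast
qed

lemma residual_in_product_preimage:
  assumes i: "i \<in> I" and S: "residual_in (X i) S"
  shows "residual_in (product_topology X I) {p \<in> topspace (product_topology X I). p i \<in> S}"
proof -
  let ?P = "product_topology X I"
  obtain \<U> where U: "countable \<U>"
      "\<And>U. U \<in> \<U> \<Longrightarrow> openin (X i) U \<and> X i closure_of U = topspace (X i)"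
      "topspace (X i) \<inter> \<Inter>\<U> \<subseteq> S"
    using S unfolding residual_in_iff_dense_open by blast
  have "residual_in ?P {p \<in> topspace ?P. p i \<in> U}" if "U \<in> \<U>" for U
  proof (rule residual_in_dense_open)
    show "openin ?P {p \<in> topspace ?P. p i \<in> U}"
      using U(2)[OF that] i
      by (intro openin_continuous_map_preimage[OF continuous_map_product_projection]) auto
    show "?P closure_of {p \<in> topspace ?P. p i \<in> U} = topspace ?P"
    proof (rule dense_in_product_if_fibres_dense[OF i])
      fix q assume q: "q \<in> topspace ?P"
      have "q(i := y) \<in> topspace ?P" if "y \<in> topspace (X i)" for y
        using q i that by (auto simp: PiE_iff extensional_def)
      then have "{y \<in> topspace (X i). q(i := y) \<in> {p \<in> topspace ?P. p i \<in> U}} = U"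
        using openin_subset[of "X i" U] U(2)[OF \<open>U \<in> \<U>\<close>] by auto
      then show "X i closure_of {y \<in> topspace (X i). q(i := y) \<in> {p \<in> topspace ?P. p i \<in> U}}
          = topspace (X i)"
        using U(2)[OF that] by simp
    qed
  qed
  then have "residual_in ?P (topspace ?P \<inter> (\<Inter>U\<in>\<U>. {p \<in> topspace ?P. p i \<in> U}))"
    by (rule residual_in_INT[OF U(1)])
  then show ?thesis
    by (rule residual_in_mono) (use U(3) i in \<open>auto simp: PiE_iff extensional_def\<close>)
qed

text \<open>
  Varying the coordinate \<open>i\<close> alone, only the value \<open>g (p j)\<close> is excluded, and a single point is
  negligible where no point is isolated.
\<close>

lemma residual_in_product_not_graph:
  fixes M :: "'a::metric_space set"
  assumes ij: "i \<in> I" "j \<in> I" "i \<noteq> j"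
    and cont: "continuous_on M g" and perfect: "\<And>x. x \<in> M \<Longrightarrow> x islimpt M"
  shows "residual_in (product_topology (\<lambda>_. top_of_set M) I)
           {p \<in> PiE I (\<lambda>_. M). g (p j) \<noteq> p i}"
proof (rule residual_in_dense_open)
  let ?P = "product_topology (\<lambda>_. top_of_set M) I"
  let ?U = "{p \<in> PiE I (\<lambda>_. M). g (p j) \<noteq> p i}"
  have "continuous_map ?P euclidean (\<lambda>p. p i)" "continuous_map ?P (top_of_set M) (\<lambda>p. p j)"
    using ij continuous_map_product_projection[of _ I "\<lambda>_. top_of_set M"]
    by (auto simp: continuous_map_in_subtopology)
  moreover have "continuous_map (top_of_set M) euclidean g"
    using cont by simp
  ultimately have "continuous_map ?P euclidean (\<lambda>p. (g (p j), p i))"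
    using continuous_map_compose[of ?P "top_of_set M" "\<lambda>p. p j" euclidean g]
    by (simp add: continuous_map_pairedI o_def flip: prod_topology_euclidean)
  then have "continuous_map ?P euclidean (\<lambda>p. dist (g (p j)) (p i))"
    using continuous_map_compose[of ?P euclidean "\<lambda>p. (g (p j), p i)" euclidean "\<lambda>(x, y). dist x y"]
    by (simp add: o_def case_prod_unfold continuous_on_dist continuous_on_fst continuous_on_snd)
  then have "openin ?P {p \<in> topspace ?P. dist (g (p j)) (p i) \<in> - {0}}"
    by (rule openin_continuous_map_preimage) auto
  then show "openin ?P ?U"
    by simp
  show "?P closure_of ?U = topspace ?P"
  proof (rule dense_in_product_if_fibres_dense[OF ij(1)])
    fix q assume "q \<in> topspace ?P"
    then have q: "q \<in> PiE I (\<lambda>_. M)"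
      by simp
    show "top_of_set M closure_of {y \<in> topspace (top_of_set M). q(i := y) \<in> ?U}
        = topspace (top_of_set M)"
      unfolding dense_intersects_open
    proof (intro allI impI, elim conjE)
      fix T assume T: "openin (top_of_set M) T" "T \<noteq> {}"
      then obtain O' x where O': "open O'" "T = M \<inter> O'" and x: "x \<in> T"
        by (auto simp: openin_open)
      then obtain y where y: "y \<in> T" "y \<noteq> g (q j)"
        using perfect[of x] by (metis Int_iff islimpt_def)
      then have "q(i := y) \<in> ?U"
        using q ij O' by (auto simp: PiE_iff extensional_def)
      then show "{y \<in> topspace (top_of_set M). q(i := y) \<in> ?U} \<inter> T \<noteq> {}"
        using y O' by auto
    qed
  qed
qed

section \<open>Generic centers in systems with dense backward orbits\<close>

definition dense_backward_orbit :: "'a::topological_space set \<Rightarrow> ('a \<Rightarrow> 'a) \<Rightarrow> 'a \<Rightarrow> bool" where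
  "dense_backward_orbit M f y \<longleftrightarrow>
     (\<forall>U. openin (top_of_set M) U \<and> U \<noteq> {} \<longrightarrow> (\<exists>x\<in>U. \<exists>k. (f ^^ k) x = y))"

lemma funpow_in_invariant:
  assumes "f ` M \<subseteq> M" "x \<in> M"
  shows "(f ^^ k) x \<in> M"
  using assms by (induction k) auto

lemma continuous_on_funpow_invariant:
  assumes "continuous_on M f" "f ` M \<subseteq> M"
  shows "continuous_on M (f ^^ k)"
proof (induction k)
  case (Suc k)
  have "(f ^^ k) ` M \<subseteq> M"
    using funpow_in_invariant[OF assms(2)] by blast
  then show ?case
    using continuous_on_compose[OF Suc continuous_on_subset[OF assms(1)]] by simp
qed (simp add: continuous_on_id)

lemma hitting_time_le: "(f ^^ k) x \<in> B \<Longrightarrow> hitting_time f B x \<le> enat k"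
  by (auto simp: hitting_time_def intro: Inf_lower)

lemma less_hitting_time:
  assumes "\<And>l. l \<le> k \<Longrightarrow> (f ^^ l) x \<notin> B"
  shows "enat k < hitting_time f B x"
proof -
  have "enat (Suc k) \<le> hitting_time f B x"
    unfolding hitting_time_def using assms by (auto intro!: Inf_greatest simp: not_less_eq_eq[symmetric])
  then show ?thesis
    by (simp add: Suc_ile_eq)
qed

text \<open>
  Hole \<open>i\<close> certainly wins at stage \<open>n\<close> if the trajectory is in it at some time \<open>k\<close> and has stayed
  off the closed balls around the other centers up to then, an open condition on the starting point. For
  every \<open>m\<close>, the points that satisfy it for some \<open>n \<ge> m\<close> are dense, since they include the
  backward orbit of \<open>p i\<close>: a finite piece of trajectory that misses the other centers also misses
  all sufficiently small balls around them.
\<close>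

lemma residual_first_hits:
  fixes M :: "'a::metric_space set"
  assumes cont: "continuous_on M f" and inv: "f ` M \<subseteq> M"
    and dense: "dense_backward_orbit M f (p i)"
    and orbits: "\<And>j m. j \<in> {1..N} \<Longrightarrow> j \<noteq> i \<Longrightarrow> (f ^^ m) (p j) \<noteq> p i"
    and pos: "\<And>n. 0 < \<rho> i n" and lim: "\<And>j. j \<in> {1..N} \<Longrightarrow> \<rho> j \<longlonglongrightarrow> 0"
  shows "residual_in (top_of_set M) (first_hits M f N p \<rho> i)"
proof -
  let ?J = "{1..N} - {i}"
  \<comment> \<open>Asking the trajectory to avoid the closed balls, not just the holes, makes this set open.\<close>
  define G where "G n k = {x \<in> M. (f ^^ k) x \<in> ball (p i) (\<rho> i n)} \<inter>
      (\<Inter>l\<in>{..k}. \<Inter>j\<in>?J. {x \<in> M. (f ^^ l) x \<in> - cball (p j) (\<rho> j n)})" for n k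
  have pre: "openin (top_of_set M) {x \<in> M. (f ^^ k) x \<in> V}" if "open V" for k V
    using continuous_openin_preimage_gen[OF continuous_on_funpow_invariant[OF cont inv] that, of k]
    by (simp add: vimage_def Int_def)
  have openG: "openin (top_of_set M) (G n k)" for n k
  proof -
    have fin: "openin (top_of_set M) (M \<inter> (\<Inter>a\<in>A. S a))"
      if "finite A" "\<And>a. a \<in> A \<Longrightarrow> openin (top_of_set M) (S a)" for A :: "nat set" and S
      using that by (induction A rule: finite_induct) (auto simp: Int_left_commute[of M])
    have "openin (top_of_set M) ({x \<in> M. (f ^^ k) x \<in> ball (p i) (\<rho> i n)} \<inter>
      (M \<inter> (\<Inter>l\<in>{..k}. M \<inter> (\<Inter>j\<in>?J. {x \<in> M. (f ^^ l) x \<in> - cball (p j) (\<rho> j n)}))))"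
      by (intro openin_Int fin pre) auto
    also have "\<dots> = G n k"
      by (auto simp: G_def)
    finally show ?thesis .
  qed
  let ?H = "\<lambda>m. \<Union>n\<in>{m..}. \<Union>k. G n k"
  have "residual_in (top_of_set M) (?H m)" for m
  proof (rule residual_in_dense_open)
    show "openin (top_of_set M) (?H m)"
      using openG by blast
    show "top_of_set M closure_of ?H m = topspace (top_of_set M)"
      unfolding dense_intersects_open
    proof (intro allI impI)
      fix T assume T: "openin (top_of_set M) T \<and> T \<noteq> {}"
      then obtain x k where x: "x \<in> T" "(f ^^ k) x = p i"
        using dense unfolding dense_backward_orbit_def by blast
      then have xM: "x \<in> M"
        using T openin_imp_subset by blast
      \<comment> \<open>A center met on the way to \<open>p i\<close> would have \<open>p i\<close> on its forward orbit.\<close>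
      have avoid: "(f ^^ l) x \<noteq> p j" if "l \<le> k" "j \<in> ?J" for l j
      proof
        assume "(f ^^ l) x = p j"
        then have "(f ^^ (k - l)) (p j) = (f ^^ (k - l + l)) x"
          by (simp add: funpow_add)
        then show False
          using that x orbits by auto
      qed
      have "\<forall>\<^sub>F n in sequentially. \<forall>l\<in>{..k}. \<forall>j\<in>?J. \<rho> j n < dist (p j) ((f ^^ l) x)"
      proof (intro eventually_ball_finite ballI)
        fix l j assume "l \<in> {..k}" "j \<in> ?J"
        then show "\<forall>\<^sub>F n in sequentially. \<rho> j n < dist (p j) ((f ^^ l) x)"
          using avoid[of l j] by (intro order_tendstoD(2)[OF lim]) auto
      qed auto
      then obtain n0 where n0: "\<And>n. n \<ge> n0 \<Longrightarrow>
          \<forall>l\<in>{..k}. \<forall>j\<in>?J. \<rho> j n < dist (p j) ((f ^^ l) x)"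
        unfolding eventually_sequentially by blast
      have "x \<in> G (max m n0) k"
        using n0[of "max m n0"] xM x(2) pos by (auto simp: G_def not_le)
      then show "?H m \<inter> T \<noteq> {}"
        using x(1) by (meson UN_I UNIV_I atLeast_iff disjoint_iff max.cobounded1)
    qed
  qed
  then have "residual_in (top_of_set M) (topspace (top_of_set M) \<inter> (\<Inter>m\<in>UNIV. ?H m))"
    by (intro residual_in_INT) auto
  then show ?thesis
  proof (rule residual_in_mono)
    show "topspace (top_of_set M) \<inter> (\<Inter>m\<in>UNIV. ?H m) \<subseteq> first_hits M f N p \<rho> i"
    proof
      fix x assume x: "x \<in> topspace (top_of_set M) \<inter> (\<Inter>m\<in>UNIV. ?H m)"
      have "\<exists>n\<ge>m. \<forall>j\<in>{1..N}. j \<noteq> i \<longrightarrow>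
          hitting_time f (hole M p \<rho> i n) x < hitting_time f (hole M p \<rho> j n) x" for m
      proof -
        obtain n k where n: "n \<ge> m" and G: "x \<in> G n k"
          using x by (auto simp: Bex_def dest!: spec[of _ m])
        have "hitting_time f (hole M p \<rho> i n) x \<le> enat k"
          using G funpow_in_invariant[OF inv] by (intro hitting_time_le) (auto simp: G_def hole_def)
        moreover have "enat k < hitting_time f (hole M p \<rho> j n) x" if "j \<in> ?J" for j
          using G that by (intro less_hitting_time) (force simp: G_def hole_def)
        ultimately show ?thesis
          using n by (intro exI[of _ n]) (auto intro: le_less_trans)
      qed
      then show "x \<in> first_hits M f N p \<rho> i"
        using x by (auto simp: first_hits_def INFM_nat_le)
    qed
  qed (auto simp: first_hits_def)
qed

text \<open>
  A generic tuple of centers has all backward orbits dense and no center on the forward orbit of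
  another, which is all that \<open>residual_first_hits\<close> asks of the centers.
\<close>

lemma strachite_if_generic_dense_backward_orbit:
  fixes M :: "'a::metric_space set"
  assumes cont: "continuous_on M f" and inv: "f ` M \<subseteq> M"
    and perfect: "\<And>x. x \<in> M \<Longrightarrow> x islimpt M"
    and dense: "residual_in (top_of_set M) {y \<in> M. dense_backward_orbit M f y}"
  shows "strachite M f"
  unfolding strachite_def
proof (intro allI impI)
  fix N :: nat assume N: "1 \<le> N"
  let ?P = "product_topology (\<lambda>_. top_of_set M) {1..N}"
  define D where "D i = {p \<in> topspace ?P. p i \<in> {y \<in> M. dense_backward_orbit M f y}}" for i
  define E where "E = (\<lambda>(i, j, m). {p \<in> PiE {1..N} (\<lambda>_. M). (f ^^ m) (p j) \<noteq> p i})"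
  let ?K = "{(i, j, m). i \<in> {1..N} \<and> j \<in> {1..N} \<and> i \<noteq> j}"
  define R where
    "R = (topspace ?P \<inter> (\<Inter>i\<in>{1..N}. D i)) \<inter> (topspace ?P \<inter> (\<Inter>t\<in>?K. E t))"
  have "residual_in ?P (topspace ?P \<inter> (\<Inter>i\<in>{1..N}. D i))"
  proof (rule residual_in_INT)
    show "residual_in ?P (D i)" if "i \<in> {1..N}" for i
      unfolding D_def using that dense by (rule residual_in_product_preimage)
  qed auto
  moreover have "residual_in ?P (topspace ?P \<inter> (\<Inter>t\<in>?K. E t))"
  proof (rule residual_in_INT)
    show "residual_in ?P (E t)" if "t \<in> ?K" for t
      using that perfect continuous_on_funpow_invariant[OF cont inv]
      by (auto simp: E_def intro!: residual_in_product_not_graph)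
  qed (rule countableI_type)
  ultimately have "residual_in ?P R"
    unfolding R_def by (rule residual_in_Int)
  moreover have "completely_indecisive M f N p \<rho>"
    if p: "p \<in> R"
      and \<rho>: "\<forall>i\<in>{1..N}. decseq (\<rho> i) \<and> (\<forall>n. 0 < \<rho> i n) \<and> \<rho> i \<longlonglongrightarrow> 0" for p \<rho>
  proof -
    have pM: "\<And>i. i \<in> {1..N} \<Longrightarrow> p i \<in> M \<and> dense_backward_orbit M f (p i)"
      using p by (auto simp: R_def D_def)
    have orb: "(f ^^ m) (p j) \<noteq> p i" if "i \<in> {1..N}" "j \<in> {1..N}" "j \<noteq> i" for i j m
    proof -
      have "p \<in> E (i, j, m)"
        using p that unfolding R_def by auto
      then show ?thesis
        by (simp add: E_def)
    qed
    have "residual_in (top_of_set M) (first_hits M f N p \<rho> i)" if "i \<in> {1..N}" for i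
    proof (rule residual_first_hits[OF cont inv])
      show "dense_backward_orbit M f (p i)"
        using pM that by blast
      show "(f ^^ m) (p j) \<noteq> p i" if "j \<in> {1..N}" "j \<noteq> i" for j m
        using orb \<open>i \<in> {1..N}\<close> that by blast
      show "0 < \<rho> i n" for n
        using \<rho> that by blast
      show "\<rho> j \<longlonglongrightarrow> 0" if "j \<in> {1..N}" for j
        using \<rho> that by blast
    qed
    then have "residual_in (top_of_set M)
        (topspace (top_of_set M) \<inter> (\<Inter>i\<in>{1..N}. first_hits M f N p \<rho> i))"
      by (intro residual_in_INT) auto
    moreover have "topspace (top_of_set M) \<inter> (\<Inter>i\<in>{1..N}. first_hits M f N p \<rho> i)
        = (\<Inter>i\<in>{1..N}. first_hits M f N p \<rho> i)"
      using N by (force simp: first_hits_def)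
    ultimately show ?thesis
      by (simp add: completely_indecisive_def)
  qed
  ultimately show "\<exists>R. residual_in ?P R \<and> (\<forall>p\<in>R. inj_on p {1..N} \<longrightarrow>
      (\<forall>\<rho>. (\<forall>i\<in>{1..N}. decseq (\<rho> i) \<and> (\<forall>n. 0 < \<rho> i n) \<and> \<rho> i \<longlonglongrightarrow> 0) \<longrightarrow>
        completely_indecisive M f N p \<rho>))"
    by blast
qed

section \<open>Transitive maps\<close>

text \<open>All images \<open>f\<^sup>k M\<close> with \<open>k \<ge> 1\<close> lie in the closed set \<open>f M\<close>, so transitivity makes it dense.\<close>

lemma transitive_surj:
  fixes M :: "'a::t2_space set"
  assumes "compact M" and cont: "continuous_on M f" and inv: "f ` M \<subseteq> M"
    and trans: "topologically_transitive_on M f"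
  shows "f ` M = M"
proof (rule ccontr)
  assume "f ` M \<noteq> M"
  then have ne: "M - f ` M \<noteq> {}" "M \<noteq> {}"
    using inv by auto
  have "closed (f ` M)"
    using assms compact_continuous_image compact_imp_closed by blast
  then have "openin (top_of_set M) (M - f ` M)"
    by (simp add: Diff_eq open_Compl openin_open_Int)
  then obtain k where "k \<ge> 1" "(M - f ` M) \<inter> (f ^^ k) ` M \<noteq> {}"
    using trans ne unfolding topologically_transitive_on_def by (metis openin_subtopology_self)
  moreover from \<open>k \<ge> 1\<close> obtain l where "k = Suc l"
    by (cases k) auto
  ultimately show False
    using funpow_in_invariant[OF inv] by auto
qed

text \<open>
  Transitivity only gives some time at which \<open>J\<close> meets \<open>U\<close>; applied to the preimage of \<open>U\<close> under
  \<open>f\<^sup>k\<close>, which is nonempty because \<open>f\<close> is surjective, it gives a time not before \<open>k\<close>.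
\<close>

lemma transitive_late_hit:
  fixes M :: "'a::t2_space set"
  assumes "compact M" and cont: "continuous_on M f" and inv: "f ` M \<subseteq> M"
    and trans: "topologically_transitive_on M f"
    and J: "openin (top_of_set M) J" "J \<noteq> {}" and U: "openin (top_of_set M) U" "U \<noteq> {}"
  obtains m x where "x \<in> J" "(f ^^ (k + m)) x \<in> U"
proof -
  have surj: "(f ^^ k) ` M = M"
    using transitive_surj[OF assms(1-4)] by (induction k) (simp, metis funpow.simps(2) image_comp)
  let ?V = "M \<inter> (f ^^ k) -` U"
  have "openin (top_of_set M) ?V"
    using continuous_openin_preimage[OF continuous_on_funpow_invariant[OF cont inv], of k M U]
      funpow_in_invariant[OF inv] U(1) by blast
  moreover have "?V \<noteq> {}"
  proof -
    obtain u where u: "u \<in> U"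
      using U(2) by blast
    then have "u \<in> (f ^^ k) ` M"
      using surj openin_imp_subset[OF U(1)] by blast
    then show ?thesis
      using u by blast
  qed
  ultimately obtain m where "?V \<inter> (f ^^ m) ` J \<noteq> {}"
    using trans J unfolding topologically_transitive_on_def by metis
  then obtain x where "x \<in> J" "(f ^^ m) x \<in> ?V"
    by blast
  then show ?thesis
    using that[of x m] by (simp add: funpow_add)
qed

text \<open>
  If \<open>f\<^sup>k\<close> collapsed \<open>J\<close> to \<open>q\<close>, then the orbit of \<open>q\<close> would be dense, hence would return to \<open>J\<close> and
  then to \<open>q\<close>. A periodic orbit is finite and cannot be dense where no point is isolated.
\<close>

lemma transitive_iterate_not_constant:
  fixes M :: "'a::metric_space set"
  assumes "compact M" and cont: "continuous_on M f" and inv: "f ` M \<subseteq> M"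
    and trans: "topologically_transitive_on M f"
    and perfect: "\<And>x. x \<in> M \<Longrightarrow> x islimpt M"
    and J: "openin (top_of_set M) J" "J \<noteq> {}"
  shows "(f ^^ k) ` J \<noteq> {q}"
proof
  assume q: "(f ^^ k) ` J = {q}"
  \<comment> \<open>With \<open>m > 0\<close>, the period \<open>k + m\<close> found below is positive even if \<open>k = 0\<close>.\<close>
  have dense: "\<exists>m>0. (f ^^ m) q \<in> U" if U: "openin (top_of_set M) U" "U \<noteq> {}" for U
  proof -
    obtain m x where x: "x \<in> J" and "(f ^^ (Suc k + m)) x \<in> U"
      using transitive_late_hit[OF assms(1-4) J U] .
    moreover have "(f ^^ (Suc k + m)) x = (f ^^ Suc m) ((f ^^ k) x)"
      by (metis add.commute add_Suc_shift comp_apply funpow_add)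
    ultimately have "(f ^^ Suc m) q \<in> U"
      using q by auto
    then show ?thesis
      by blast
  qed
  obtain m where m: "m > 0" "(f ^^ m) q \<in> J"
    using dense[OF J] by blast
  then have per: "(f ^^ (k + m)) q = q"
    using q by (auto simp: funpow_add)
  let ?F = "(\<lambda>l. (f ^^ l) q) ` {..<k + m}"
  have orbit: "(f ^^ l) q \<in> ?F" for l
    using funpow_mod_eq[OF per, of l] m(1) by (metis imageI lessThan_iff mod_less_divisor add_gr_0)
  have "infinite M"
    using J perfect islimpt_finite openin_imp_subset[OF J(1)] by blast
  then have "M - ?F \<noteq> {}"
    using finite_subset[of M ?F] by blast
  moreover have "openin (top_of_set M) (M - ?F)"
    by (simp add: Diff_eq open_Compl openin_open_Int finite_imp_closed)
  ultimately show False
    using dense[of "M - ?F"] orbit by blast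
qed

section \<open>Transitive interval maps\<close>

lemma connected_subset_closure_interior_real:
  fixes S :: "real set"
  assumes "connected S" "S \<noteq> {}" "\<And>q. S \<noteq> {q}"
  shows "S \<subseteq> closure (interior S)"
proof -
  obtain x y where xy: "x \<in> S" "y \<in> S" "x < y"
    using assms(2,3) by (metis all_not_in_conv linorder_neqE subset_singletonD subsetI singletonI)
  then have "{x<..<y} \<subseteq> S"
    using assms(1) connected_contains_Icc[of S x y] by fastforce
  then have "{x<..<y} \<subseteq> interior S"
    by (simp add: interior_maximal)
  then have "interior S \<noteq> {}"
    using xy(3) by (metis dense empty_iff greaterThanLessThan_iff subset_empty)
  then show ?thesis
    using assms(1) convex_closure_interior[of S] closure_subset[of S]
    by (simp add: connected_convex_1)
qed

lemma rational_interval_in_relatively_open: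
  fixes a b :: real
  assumes "a < b" "openin (top_of_set {a..b}) U" "U \<noteq> {}"
  obtains r s where "r \<in> \<rat>" "s \<in> \<rat>" "r < s" "{r<..<s} \<subseteq> U"
proof -
  obtain V x where V: "open V" "U = {a..b} \<inter> V" and x: "x \<in> U"
    using assms(2,3) unfolding openin_open by blast
  have "x \<in> closure {a<..<b}"
    using x V assms(1) by simp
  then obtain y where y: "y \<in> {a<..<b} \<inter> V"
    using V x open_Int_closure_eq_empty[OF V(1), of "{a<..<b}"] by blast
  moreover have "open ({a<..<b} \<inter> V)"
    using V(1) by (simp add: open_Int)
  ultimately obtain e where e: "e > 0" "ball y e \<subseteq> {a<..<b} \<inter> V"
    using openE by blast
  obtain r where r: "r \<in> \<rat>" "y - e < r" "r < y"
    using Rats_dense_in_real[of "y - e" y] e(1) by auto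
  obtain s where s: "s \<in> \<rat>" "y < s" "s < y + e"
    using Rats_dense_in_real[of y "y + e"] e(1) by auto
  have "{r<..<s} \<subseteq> ball y e"
    using r s by (auto simp: dist_real_def)
  then have "{r<..<s} \<subseteq> U"
    using e(2) V(2) by fastforce
  then show ?thesis
    using that r s by (meson order.strict_trans)
qed

text \<open>
  Transitivity makes the union of the images \<open>f\<^sup>k J\<close> dense. Passing to interiors loses nothing:
  each image is an interval with more than one point, so it lies in the closure of its interior.
\<close>

lemma transitive_interval_images_interior_dense:
  fixes f :: "real \<Rightarrow> real"
  assumes ab: "a < b" and cont: "continuous_on {a..b} f" and inv: "f ` {a..b} \<subseteq> {a..b}"
    and trans: "topologically_transitive_on {a..b} f"
    and J: "openin (top_of_set {a..b}) J" "connected J" "J \<noteq> {}"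
  shows "top_of_set {a..b} closure_of (\<Union>k. interior ((f ^^ k) ` J)) = topspace (top_of_set {a..b})"
  unfolding dense_intersects_open
proof (intro allI impI, elim conjE)
  fix T assume T: "openin (top_of_set {a..b}) T" "T \<noteq> {}"
  have JM: "J \<subseteq> {a..b}"
    using J(1) openin_imp_subset by blast
  obtain V where V: "open V" "T = {a..b} \<inter> V"
    using T by (auto simp: openin_open)
  obtain k where "T \<inter> (f ^^ k) ` J \<noteq> {}"
    using trans T J unfolding topologically_transitive_on_def by blast
  then obtain z where z: "z \<in> V" "z \<in> (f ^^ k) ` J"
    using V by blast
  have "x islimpt {a..b}" if "x \<in> {a..b}" for x
    using that ab by (intro connected_imp_perfect) auto
  then have "(f ^^ k) ` J \<noteq> {q}" for q
    using transitive_iterate_not_constant[OF _ cont inv trans _ J(1,3)] by blast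
  moreover have "connected ((f ^^ k) ` J)"
    using J(2) JM continuous_on_funpow_invariant[OF cont inv]
    by (meson connected_continuous_image continuous_on_subset)
  ultimately have "z \<in> closure (interior ((f ^^ k) ` J))"
    using connected_subset_closure_interior_real[of "(f ^^ k) ` J"] z(2) by blast
  then have "V \<inter> interior ((f ^^ k) ` J) \<noteq> {}"
    using z(1) open_Int_closure_eq_empty[OF V(1)] by blast
  moreover have "interior ((f ^^ k) ` J) \<subseteq> {a..b}"
    using interior_subset JM funpow_in_invariant[OF inv] by fastforce
  ultimately show "(\<Union>k. interior ((f ^^ k) ` J)) \<inter> T \<noteq> {}"
    using V(2) by blast
qed

lemma residual_dense_backward_orbit_interval:
  fixes f :: "real \<Rightarrow> real"
  assumes ab: "a < b" and cont: "continuous_on {a..b} f" and inv: "f ` {a..b} \<subseteq> {a..b}"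
    and trans: "topologically_transitive_on {a..b} f"
  shows "residual_in (top_of_set {a..b}) {y \<in> {a..b}. dense_backward_orbit {a..b} f y}"
proof -
  let ?X = "top_of_set {a..b}"
  define W where "W = (\<lambda>(r, s). \<Union>k. interior ((f ^^ k) ` {r<..<s}))"
  define K where "K = {(r, s). r \<in> \<rat> \<and> s \<in> \<rat> \<and> r < s \<and> {r<..<s} \<subseteq> {a..b}}"
  have "countable K"
  proof (rule countable_subset)
    show "K \<subseteq> \<rat> \<times> \<rat>"
      by (auto simp: K_def)
  qed (simp add: countable_rat)
  moreover have "residual_in ?X (W t)" if "t \<in> K" for t
  proof -
    obtain r s where t: "t = (r, s)" "r < s" "{r<..<s} \<subseteq> {a..b}"
      using \<open>t \<in> K\<close> by (auto simp: K_def)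
    have "openin ?X {r<..<s}" "{r<..<s} \<noteq> {}"
      using t by (auto simp: open_subset)
    then have "?X closure_of W t = topspace ?X"
      using transitive_interval_images_interior_dense[OF assms] t(1) by (simp add: W_def)
    moreover have "W t \<subseteq> {a..b}"
      using interior_subset t funpow_in_invariant[OF inv] by (fastforce simp: W_def)
    then have "openin ?X (W t)"
      by (intro open_subset) (auto simp: W_def t(1))
    ultimately show ?thesis
      by (intro residual_in_dense_open)
  qed
  ultimately have "residual_in ?X (topspace ?X \<inter> (\<Inter>t\<in>K. W t))"
    by (rule residual_in_INT)
  then show ?thesis
  proof (rule residual_in_mono)
    show "topspace ?X \<inter> (\<Inter>t\<in>K. W t) \<subseteq> {y \<in> {a..b}. dense_backward_orbit {a..b} f y}"
    proof
      fix y assume y: "y \<in> topspace ?X \<inter> (\<Inter>t\<in>K. W t)"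
      have "\<exists>x\<in>U. \<exists>k. (f ^^ k) x = y" if U: "openin ?X U" "U \<noteq> {}" for U
      proof -
        obtain r s where rs: "r \<in> \<rat>" "s \<in> \<rat>" "r < s" "{r<..<s} \<subseteq> U"
          using rational_interval_in_relatively_open[OF ab U] .
        then have "(r, s) \<in> K"
          using openin_imp_subset[OF U(1)] by (auto simp: K_def)
        then obtain k where "y \<in> interior ((f ^^ k) ` {r<..<s})"
          using y by (auto simp: W_def)
        then show ?thesis
          using rs(4) interior_subset by blast
      qed
      then show "y \<in> {y \<in> {a..b}. dense_backward_orbit {a..b} f y}"
        using y by (simp add: dense_backward_orbit_def)
    qed
  qed auto
qed

theorem lemma14:
  fixes f :: "real \<Rightarrow> real"
  assumes "continuous_on {0..1} f"
    and "f ` {0..1} \<subseteq> {0..1}"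
    and "topologically_transitive_on {0..1} f"
  shows "strachite {0..1} f"
proof (rule strachite_if_generic_dense_backward_orbit[OF assms(1,2)])
  show "x islimpt {0..1}" if "x \<in> {0..1}" for x :: real
    using that by (intro connected_imp_perfect) auto
  show "residual_in (top_of_set {0..1}) {y \<in> {0..1}. dense_backward_orbit {0..1} f y}"
    using assms by (intro residual_dense_backward_orbit_interval) auto
qed

end
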